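(* Let $0<n<N$, $k=N-n$, $\alpha\in\Pi_{n,k}$. The on-shell Bethe vector $|y_\alpha\rangle$ obeys the quantum Knizhnik–Zamolodchikov equations with respect to the subgroup $\mathbb S_n\times\mathbb S_k\subset\mathbb S_N$ stabilising the 01-word of $\alpha$: for every $1\le j\le N-1$ such that $p_j\alpha=\alpha$ (i.e. the $j$-th and $(j+1)$-th letters of the 01-word of $\alpha$ agree), $$\hat r_j|y_\alpha\rangle=s_j|y_\alpha\rangle,\qquad\text{equivalently}\qquad\delta_j^\vee|y_\alpha\rangle=\partial_j|y_\alpha\rangle .$$
   Context: $T_1,\dots,T_N$ are indeterminates, $t_i:=T_{N+1-i}$. $V$ has basis $v_0,v_1$; $V_n$ is the span of $v_{\varepsilon_1}\otimes\cdots\otimes v_{\varepsilon_N}$ with exactly $n$ of the $\varepsilon_j\in\{0,1\}$ equal to 1. $\Pi_{n,k}=\{\lambda:k\ge\lambda_1\ge\dots\ge\lambda_n\ge0\}$, $I(\lambda)=\{\lambda_{n+1-i}+i:1\le i\le n\}$; the 01-word of $\lambda$ is $\varepsilon_1\cdots\varepsilon_N$ with $\varepsilon_j=1$ iff $j\in I(\lambda)$, and $|\lambda\rangle=v_{\varepsilon_1}\otimes\cdots\otimes v_{\varepsilon_N}$; $\lambda^\vee=(k-\lambda_n,\dots,k-\lambda_1)$; $p_j$ exchanges letters $j$ and $j+1$. With $\sigma^+v_0=v_1$, $\sigma^+v_1=0$, $\sigma^-v_1=v_0$, $\sigma^-v_0=0$: $\delta_j^\vee=\sigma_j^+\sigma_{j+1}^-$,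 $\hat r_j=1-(t_j-t_{j+1})\delta_j^\vee$. $s_j$ exchanges $t_j,t_{j+1}$ in coefficients (trivially on basis vectors and $q$), and $\partial_j=(t_j-t_{j+1})^{-1}(1-s_j)$. $\mathbb F_q=\mathbb C[q^{\pm1/N}]\widehat\otimes\mathbb C\{\!\{T_1,\dots,T_N\}\!\}$ (completed tensor product with the algebraically closed field of Puiseux series). Bethe roots: $y_1,\dots,y_N$ are the solutions of $\prod_{j=1}^N(y-t_j)+(-1)^nq=0$, numbered by $y_j|_{q=0}=t_j$ (power series in $q$ with coefficients rational in the $t$'s); permutations of the $t$'s act by $s_iy_j=y_{s_i(j)}$. $y_\alpha=(y_i)_{i\in I(\alpha)}$ and $|y_\alpha\rangle=\sum_{\lambda\in\Pi_{n,k}}s_{\lambda^\vee}(y_\alpha|T)|\lambda\rangle\in\mathbb F_q\otimes V_n$, where $s_\lambda(x|a)=\det[(x_j|a)^{\lambda_i+n-i}]/\det[(x_j|a)^{n-i}]$, $(x|a)^r=\prod_{i=1}^r(x-a_i)$. *)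

theory Defs
  imports
    "HOL-Library.Poly_Mapping"
    "HOL-Combinatorics.Transposition"
    "HOL-Computational_Algebra.Fraction_Field"
    "HOL-Computational_Algebra.Formal_Power_Series"
    "Jordan_Normal_Form.Determinant"
begin

text \<open>
  Polynomials over the complex numbers in indeterminates indexed by the natural numbers
  (a monomial is the finitely supported function giving its exponents), and their field of
  fractions. For given \<open>N\<close> only the indeterminates \<open>T\<^sub>1, \<dots>, T\<^sub>N\<close> occur.
\<close>

type_synonym mpol = "(nat \<Rightarrow>\<^sub>0 nat) \<Rightarrow>\<^sub>0 complex"
type_synonym ratfun = "mpol fract"

definition T :: "nat \<Rightarrow> ratfun" where
  "T i = Fract (Poly_Mapping.single (Poly_Mapping.single i 1) 1) 1"

definition t :: "nat \<Rightarrow> nat \<Rightarrow> ratfun" where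
  "t N i = T (N + 1 - i)"

text \<open>
  The Bethe roots are power series in \<open>q\<close> with coefficients rational in the \<open>t\<^sub>i\<close>, so
  that everything takes place in \<open>\<complex>(T\<^sub>1,\<dots>,T\<^sub>N)[[q]]\<close>, on which the symmetric group acts
  through its action on the indeterminates. The variable \<open>q\<close> is \<^const>\<open>fps_X\<close>.
\<close>

type_synonym coeff = "ratfun fps"

text \<open>
  Exchange of two indeterminates: the coefficient of a monomial in the image of \<open>p\<close> is the
  coefficient in \<open>p\<close> of the monomial with exchanged exponents.
\<close>

definition swap_mpol :: "nat \<Rightarrow> nat \<Rightarrow> mpol \<Rightarrow> mpol" where
  "swap_mpol a b = Poly_Mapping.map_key (Poly_Mapping.map_key (transpose a b))"

lemma map_key_transpose_involutory:
  "Poly_Mapping.map_key (transpose a b) (Poly_Mapping.map_key (transpose a b) m) = m"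
proof -
  have "inj (transpose a b)" by simp
  then show ?thesis
    by (intro poly_mapping_eqI) (simp add: Poly_Mapping.map_key.rep_eq)
qed

lemma map_key_transpose_inj:
  "inj (Poly_Mapping.map_key (transpose a b) :: (nat \<Rightarrow>\<^sub>0 nat) \<Rightarrow> (nat \<Rightarrow>\<^sub>0 nat))"
  by (rule inj_on_inverseI) (rule map_key_transpose_involutory)

lemma map_key_transpose_single:
  "Poly_Mapping.map_key (transpose a b) (Poly_Mapping.single i (v :: 'v :: zero))
     = Poly_Mapping.single (transpose a b i) v"
proof -
  have "inj (transpose a b)" by simp
  from Poly_Mapping.map_key_single[OF this, of "transpose a b i" v] show ?thesis by simp
qed

lemma swap_mpol_single:
  "swap_mpol a b (Poly_Mapping.single m c)
     = Poly_Mapping.single (Poly_Mapping.map_key (transpose a b) m) c"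
  using Poly_Mapping.map_key_single[OF map_key_transpose_inj,
      of a b "Poly_Mapping.map_key (transpose a b) m" c]
  by (simp add: swap_mpol_def map_key_transpose_involutory)

lemma swap_mpol_add: "swap_mpol a b (p + r) = swap_mpol a b p + swap_mpol a b r"
  by (simp add: swap_mpol_def Poly_Mapping.map_key_plus[OF map_key_transpose_inj])

lemma swap_mpol_0: "swap_mpol a b 0 = 0"
  by (simp add: swap_mpol_def Poly_Mapping.map_key_zero[OF map_key_transpose_inj])

lemma swap_mpol_1: "swap_mpol a b 1 = 1"
  by (simp add: swap_mpol_single Poly_Mapping.map_key_zero flip: single_one)

lemma swap_mpol_sum: "swap_mpol a b (sum f A) = (\<Sum>x\<in>A. swap_mpol a b (f x))"
  by (induction A rule: infinite_finite_induct) (simp_all add: swap_mpol_0 swap_mpol_add)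

lemma swap_mpol_involutory: "swap_mpol a b (swap_mpol a b p) = p"
  by (intro poly_mapping_eqI)
    (simp add: swap_mpol_def Poly_Mapping.map_key.rep_eq[OF map_key_transpose_inj]
      map_key_transpose_involutory)

lemma swap_mpol_eq_0_iff: "swap_mpol a b p = 0 \<longleftrightarrow> p = 0"
  by (metis swap_mpol_0 swap_mpol_involutory)

lemma swap_mpol_mult: "swap_mpol a b (p * r) = swap_mpol a b p * swap_mpol a b r"
proof -
  have decomp: "p = (\<Sum>m\<in>Poly_Mapping.keys p. Poly_Mapping.single m (Poly_Mapping.lookup p m))"
    for p :: mpol
    by (rule poly_mapping_eqI)
      (auto simp: lookup_sum lookup_single when_def sum.If_cases in_keys_iff)
  have mono: "swap_mpol a b (Poly_Mapping.single m c * Poly_Mapping.single m' c')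
     = swap_mpol a b (Poly_Mapping.single m c) * swap_mpol a b (Poly_Mapping.single m' c')"
    for m m' c c'
    by (simp add: mult_single swap_mpol_single Poly_Mapping.map_key_plus)
  have "swap_mpol a b ((\<Sum>m\<in>K. Poly_Mapping.single m (f m)) * (\<Sum>m\<in>L. Poly_Mapping.single m (g m)))
     = swap_mpol a b (\<Sum>m\<in>K. Poly_Mapping.single m (f m))
       * swap_mpol a b (\<Sum>m\<in>L. Poly_Mapping.single m (g m))" for K L f g
    by (simp only: sum_product swap_mpol_sum mono)
  from this[of "Poly_Mapping.lookup p" "Poly_Mapping.keys p"
      "Poly_Mapping.lookup r" "Poly_Mapping.keys r"]
  show ?thesis by (simp flip: decomp)
qed

definition swap_ratfun :: "nat \<Rightarrow> nat \<Rightarrow> ratfun \<Rightarrow> ratfun" where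
  "swap_ratfun a b x =
     (THE z. \<exists>p r. r \<noteq> 0 \<and> x = Fract p r \<and> z = Fract (swap_mpol a b p) (swap_mpol a b r))"

lemma swap_ratfun_Fract:
  assumes "r \<noteq> 0"
  shows "swap_ratfun a b (Fract p r) = Fract (swap_mpol a b p) (swap_mpol a b r)"
  unfolding swap_ratfun_def
proof (rule the_equality)
  fix z assume "\<exists>p' r'. r' \<noteq> 0 \<and> Fract p r = Fract p' r'
      \<and> z = Fract (swap_mpol a b p') (swap_mpol a b r')"
  then obtain p' r' where *: "r' \<noteq> 0" "Fract p r = Fract p' r'"
    "z = Fract (swap_mpol a b p') (swap_mpol a b r')" by blast
  with assms have "p * r' = p' * r" by (simp add: eq_fract)
  then have "swap_mpol a b p * swap_mpol a b r' = swap_mpol a b p' * swap_mpol a b r"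
    by (simp flip: swap_mpol_mult)
  with * assms show "z = Fract (swap_mpol a b p) (swap_mpol a b r)"
    by (simp add: eq_fract swap_mpol_eq_0_iff)
qed (use assms in blast)

lemma swap_ratfun_add: "swap_ratfun a b (x + y) = swap_ratfun a b x + swap_ratfun a b y"
  by (cases x; cases y)
    (simp add: swap_ratfun_Fract swap_mpol_eq_0_iff swap_mpol_add swap_mpol_mult)

lemma swap_ratfun_mult: "swap_ratfun a b (x * y) = swap_ratfun a b x * swap_ratfun a b y"
  by (cases x; cases y)
    (simp add: swap_ratfun_Fract swap_mpol_eq_0_iff swap_mpol_mult)

lemma swap_ratfun_0: "swap_ratfun a b 0 = 0"
  by (simp add: Zero_fract_def swap_ratfun_Fract swap_mpol_0 swap_mpol_1)

lemma swap_ratfun_1: "swap_ratfun a b 1 = 1"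
  by (simp add: One_fract_def swap_ratfun_Fract swap_mpol_1)

lemma swap_ratfun_T: "swap_ratfun a b (T i) = T (transpose a b i)"
  by (simp add: T_def swap_ratfun_Fract swap_mpol_single map_key_transpose_single swap_mpol_1)

text \<open>
  \<open>s\<^sub>j\<close> exchanges \<open>t\<^sub>j\<close> and \<open>t\<^sub>j\<^sub>+\<^sub>1\<close> in the coefficients of a power series in \<open>q\<close> and fixes \<open>q\<close>.
\<close>

definition s_coeff :: "nat \<Rightarrow> nat \<Rightarrow> coeff \<Rightarrow> coeff" where
  "s_coeff N j f = Abs_fps (\<lambda>i. swap_ratfun (N + 1 - j) (N + 1 - (j + 1)) (fps_nth f i))"

lemma s_coeff_add: "s_coeff N j (f + g) = s_coeff N j f + s_coeff N j g"
  by (rule fps_ext) (simp add: s_coeff_def swap_ratfun_add)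

lemma s_coeff_0: "s_coeff N j 0 = 0"
  by (rule fps_ext) (simp add: s_coeff_def swap_ratfun_0)

lemma s_coeff_1: "s_coeff N j 1 = 1"
  by (rule fps_ext) (simp add: s_coeff_def swap_ratfun_0 swap_ratfun_1)

lemma s_coeff_X: "s_coeff N j fps_X = fps_X"
  by (rule fps_ext) (simp add: s_coeff_def fps_X_def swap_ratfun_0 swap_ratfun_1)

lemma s_coeff_mult: "s_coeff N j (f * g) = s_coeff N j f * s_coeff N j g"
proof -
  have *: "swap_ratfun a b (sum h A) = (\<Sum>x\<in>A. swap_ratfun a b (h x))"
    for a b h and A :: "nat set"
    by (induction A rule: infinite_finite_induct) (simp_all add: swap_ratfun_0 swap_ratfun_add)
  show ?thesis
    by (rule fps_ext) (simp add: s_coeff_def fps_mult_nth swap_ratfun_mult *)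
qed

lemma s_coeff_uminus: "s_coeff N j (- f) = - s_coeff N j f"
  by (metis add.right_inverse add_eq_0_iff s_coeff_0 s_coeff_add)

lemma s_coeff_t:
  assumes "1 \<le> j" "j \<le> N - 1" "1 \<le> i" "i \<le> N"
  shows "s_coeff N j (fps_const (t N i)) = fps_const (t N (transpose j (j + 1) i))"
proof -
  have "transpose (N + 1 - j) (N + 1 - (j + 1)) (N + 1 - i) = N + 1 - transpose j (j + 1) i"
    using assms by (auto simp: transpose_def)
  then show ?thesis
    by (intro fps_ext) (simp add: s_coeff_def t_def swap_ratfun_T swap_ratfun_0)
qed

definition bethe_poly :: "nat \<Rightarrow> nat \<Rightarrow> coeff \<Rightarrow> coeff" where
  "bethe_poly N n y = (\<Prod>j = 1..N. y - fps_const (t N j)) + (-1) ^ n * fps_X"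

definition bethe_root :: "nat \<Rightarrow> nat \<Rightarrow> nat \<Rightarrow> coeff" where
  "bethe_root N n j = (THE y. bethe_poly N n y = 0 \<and> fps_nth y 0 = t N j)"

lemma T_inject: "T i = T j \<longleftrightarrow> i = j"
proof -
  have "Poly_Mapping.single i (1::nat) = Poly_Mapping.single j 1 \<longleftrightarrow> i = j" for i j :: nat
    by (metis lookup_single_eq lookup_single_not_eq zero_neq_one)
  moreover have "Poly_Mapping.single m (1::complex) = Poly_Mapping.single m' 1 \<longleftrightarrow> m = m'"
    for m m' :: "nat \<Rightarrow>\<^sub>0 nat"
    by (metis lookup_single_eq lookup_single_not_eq zero_neq_one)
  ultimately show ?thesis by (simp add: T_def eq_fract)
qed

text \<open>The definite description is justified: each \<open>t\<^sub>j\<close> lifts to exactly one solution.\<close>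

lemma bethe_root_ex1:
  assumes j: "1 \<le> j" "j \<le> N"
  shows "\<exists>!y. bethe_poly N n y = 0 \<and> fps_nth y 0 = t N j"
proof -
  define G where "G = (\<Prod>i = 1..N. fps_const (t N j - t N i) + fps_X)"
  define H where "H = (\<Prod>i \<in> {1..N} - {j}. fps_const (t N j - t N i) + fps_X)"
  define c where "c = - ((-1) ^ n * (fps_X :: coeff))"
  have c0: "fps_nth c 0 = 0" by (simp add: c_def)
  have "G = fps_X * H"
    using j by (simp add: G_def H_def prod.remove[of "{Suc 0..N}" j])
  moreover have "fps_nth H 0 \<noteq> 0"
  proof -
    have "fps_nth (\<Prod>i \<in> A. fps_const (t N j - t N i) + fps_X) 0 = (\<Prod>i \<in> A. t N j - t N i)"
      for A by (induction A rule: infinite_finite_induct) simp_all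
    moreover have "t N j \<noteq> t N i" if "i \<in> {1..N} - {j}" for i
      using that j by (auto simp: t_def T_inject)
    ultimately show ?thesis by (simp add: H_def)
  qed
  ultimately have G0: "fps_nth G 0 = 0" and G1: "fps_nth G 1 \<noteq> 0"
    by simp_all
  have I0: "fps_nth (fps_inv G) 0 = 0" by (simp add: fps_inv_def)
  have key: "bethe_poly N n (fps_const (t N j) + z) = 0 \<longleftrightarrow> z = fps_inv G oo c"
    if z0: "fps_nth z 0 = 0" for z
  proof -
    have "G oo z = (\<Prod>i = 1..N. (fps_const (t N j) + z) - fps_const (t N i))"
      unfolding G_def using z0
      by (subst fps_compose_prod_distrib[OF z0], intro prod.cong)
        (auto simp: fps_compose_add_distrib fps_compose_sub_distrib simp flip: fps_const_sub)
    then have "bethe_poly N n (fps_const (t N j) + z) = 0 \<longleftrightarrow> G oo z = c"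
      by (simp add: bethe_poly_def c_def eq_neg_iff_add_eq_0)
    also have "\<dots> \<longleftrightarrow> z = fps_inv G oo c"
    proof
      assume "G oo z = c"
      then have "fps_inv G oo c = (fps_inv G oo G) oo z"
        using fps_compose_assoc[OF z0 G0, of "fps_inv G"] by simp
      then show "z = fps_inv G oo c"
        using fps_inv[OF G0 G1] z0 by simp
    next
      assume "z = fps_inv G oo c"
      then have "G oo z = (G oo fps_inv G) oo c"
        using fps_compose_assoc[OF c0 I0, of G] by simp
      then show "G oo z = c"
        using fps_inv_right[OF G0 G1] c0 by simp
    qed
    finally show ?thesis .
  qed
  show ?thesis
  proof (rule ex1I[of _ "fps_const (t N j) + (fps_inv G oo c)"])
    show "bethe_poly N n (fps_const (t N j) + (fps_inv G oo c)) = 0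
        \<and> fps_nth (fps_const (t N j) + (fps_inv G oo c)) 0 = t N j"
      using key[of "fps_inv G oo c"] I0 by simp
  next
    fix y assume y: "bethe_poly N n y = 0 \<and> fps_nth y 0 = t N j"
    define z where "z = y - fps_const (t N j)"
    have "z = fps_inv G oo c" using key[of z] y by (simp add: z_def)
    then show "y = fps_const (t N j) + (fps_inv G oo c)" by (simp add: z_def algebra_simps)
  qed
qed

lemma s_coeff_bethe_root:
  assumes j: "1 \<le> j" "j \<le> N - 1" and i: "1 \<le> i" "i \<le> N"
  shows "s_coeff N j (bethe_root N n i) = bethe_root N n (transpose j (j + 1) i)"
proof -
  let ?s = "transpose j (j + 1)" and ?y = "bethe_root N n i"
  have y: "bethe_poly N n ?y = 0" "fps_nth ?y 0 = t N i"
    using theI'[OF bethe_root_ex1[OF i, of n]] unfolding bethe_root_def by blast+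
  have si: "1 \<le> ?s i" "?s i \<le> N" using i j by (auto simp: transpose_def)
  have sp: "s_coeff N j (prod f A) = (\<Prod>x\<in>A. s_coeff N j (f x))" for f and A :: "nat set"
    by (induction A rule: infinite_finite_induct) (simp_all add: s_coeff_1 s_coeff_mult)
  have spow: "s_coeff N j ((-1) ^ n) = (-1) ^ n"
    by (induction n) (simp_all add: s_coeff_1 s_coeff_mult s_coeff_uminus)
  have sd: "s_coeff N j (f - g) = s_coeff N j f - s_coeff N j g" for f g
    using s_coeff_add[of N j f "- g"] by (simp add: s_coeff_uminus)
  have bij: "bij_betw ?s {1..N} {1..N}"
    by (rule bij_betw_byWitness[where f' = ?s]) (use j in \<open>auto simp: transpose_def\<close>)
  have "0 = s_coeff N j (bethe_poly N n ?y)" by (simp only: y s_coeff_0)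
  also have "\<dots> = (\<Prod>l = 1..N. s_coeff N j ?y - fps_const (t N (?s l))) + (-1) ^ n * fps_X"
    unfolding bethe_poly_def s_coeff_add s_coeff_mult spow s_coeff_X sp sd
    by (intro arg_cong2[where f = "(+)"] prod.cong refl, subst s_coeff_t[OF j]) simp_all
  also have "(\<Prod>l = 1..N. s_coeff N j ?y - fps_const (t N (?s l)))
      = (\<Prod>l = 1..N. s_coeff N j ?y - fps_const (t N l))"
    by (rule prod.reindex_bij_betw[OF bij])
  finally have "bethe_poly N n (s_coeff N j ?y) = 0" by (simp add: bethe_poly_def)
  moreover have "fps_nth (s_coeff N j ?y) 0 = t N (?s i)"
    using arg_cong[OF s_coeff_t[OF j i], of "\<lambda>f. fps_nth f 0"]
    by (simp only: s_coeff_def fps_nth_Abs_fps fps_nth_fps_const y if_True simp_thms)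
  ultimately show ?thesis
    unfolding bethe_root_def[of N n "?s i"]
    by (intro the1_equality[symmetric, OF bethe_root_ex1[OF si, of n]] conjI)
qed

text \<open>A partition is the list of its \<open>n\<close> parts, so that \<open>\<lambda>\<^sub>i\<close> is \<open>lam ! (i - 1)\<close>.\<close>

definition partitions_in_box :: "nat \<Rightarrow> nat \<Rightarrow> nat list set" where
  "partitions_in_box n k = {lam. length lam = n \<and> sorted_wrt (\<ge>) lam \<and> (\<forall>x \<in> set lam. x \<le> k)}"

definition I_set :: "nat list \<Rightarrow> nat set" where
  "I_set lam = {lam ! (length lam + 1 - i - 1) + i | i. 1 \<le> i \<and> i \<le> length lam}"

definition dual_partition :: "nat \<Rightarrow> nat list \<Rightarrow> nat list" where
  "dual_partition k lam = rev (map (\<lambda>x. k - x) lam)"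

text \<open>
  01-words are Boolean lists with \<^const>\<open>True\<close> for the letter 1; letter \<open>j\<close> of \<open>w\<close> is
  \<open>w ! (j - 1)\<close>.
\<close>

type_synonym word01 = "bool list"

definition word :: "nat \<Rightarrow> nat list \<Rightarrow> word01" where
  "word N lam = map (\<lambda>j. j \<in> I_set lam) [1..<N + 1]"

definition p_word :: "nat \<Rightarrow> word01 \<Rightarrow> word01" where
  "p_word j w = w[j - 1 := w ! j, j := w ! (j - 1)]"

text \<open>
  The vector \<open>v\<^bsub>\<epsilon>\<^sub>1\<^esub> \<otimes> \<dots> \<otimes> v\<^bsub>\<epsilon>\<^sub>N\<^esub>\<close> is represented by the word \<open>\<epsilon>\<^sub>1 \<dots> \<epsilon>\<^sub>N\<close>, so the
  type of states is the free module over \<^typ>\<open>coeff\<close> on all words, i.e. the tensor algebra of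
  the span of \<open>v\<^sub>0, v\<^sub>1\<close>; the words of length \<open>N\<close> span its \<open>N\<close>-th tensor power.
\<close>

type_synonym state = "word01 \<Rightarrow>\<^sub>0 coeff"

definition ket :: "word01 \<Rightarrow> state" where
  "ket w = Poly_Mapping.single w 1"

definition smul :: "coeff \<Rightarrow> state \<Rightarrow> state" where
  "smul c v = Poly_Mapping.map (\<lambda>x. c * x) v"

definition linear_extension :: "(word01 \<Rightarrow> state) \<Rightarrow> state \<Rightarrow> state" where
  "linear_extension \<phi> v = (\<Sum>w \<in> Poly_Mapping.keys v. smul (Poly_Mapping.lookup v w) (\<phi> w))"

definition sigma_plus :: "nat \<Rightarrow> state \<Rightarrow> state" where
  "sigma_plus j = linear_extension (\<lambda>w. if w ! (j - 1) then 0 else ket (w[j - 1 := True]))"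

definition sigma_minus :: "nat \<Rightarrow> state \<Rightarrow> state" where
  "sigma_minus j = linear_extension (\<lambda>w. if w ! (j - 1) then ket (w[j - 1 := False]) else 0)"

definition delta_check :: "nat \<Rightarrow> state \<Rightarrow> state" where
  "delta_check j v = sigma_plus j (sigma_minus (j + 1) v)"

definition r_hat :: "nat \<Rightarrow> nat \<Rightarrow> state \<Rightarrow> state" where
  "r_hat N j v = v - smul (fps_const (t N j - t N (j + 1))) (delta_check j v)"

definition s_state :: "nat \<Rightarrow> nat \<Rightarrow> state \<Rightarrow> state" where
  "s_state N j v = Poly_Mapping.map (s_coeff N j) v"

definition partial_state :: "nat \<Rightarrow> nat \<Rightarrow> state \<Rightarrow> state" where
  "partial_state N j v = smul (fps_const (inverse (t N j - t N (j + 1)))) (v - s_state N j v)"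

definition factorial_power :: "coeff \<Rightarrow> (nat \<Rightarrow> coeff) \<Rightarrow> nat \<Rightarrow> coeff" where
  "factorial_power x a r = (\<Prod>i = 1..r. x - a i)"

text \<open>
  Matrix indices start at 0, so entry \<open>(i, j)\<close> below is the entry of the paper in row
  \<open>i + 1\<close> and column \<open>j + 1\<close>. The quotient is an honest one whenever the
  \<open>fps_nth (xs ! j) 0\<close> are pairwise distinct, as for Bethe roots: the denominator is then the
  Vandermonde determinant of \<open>xs\<close>, a unit of the power series ring.
\<close>

definition factorial_schur :: "nat list \<Rightarrow> coeff list \<Rightarrow> (nat \<Rightarrow> coeff) \<Rightarrow> coeff" where
  "factorial_schur lam xs a = (let n = length lam in
     det (mat n n (\<lambda>(i, j). factorial_power (xs ! j) a (lam ! i + n - (i + 1)))) /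
     det (mat n n (\<lambda>(i, j). factorial_power (xs ! j) a (n - (i + 1)))))"

text \<open>
  The family \<open>(y\<^sub>i)\<close>, \<open>i \<in> I(\<alpha>)\<close>, is listed by increasing \<open>i\<close>; factorial Schur functions do
  not depend on the order of their arguments.
\<close>

definition y_tuple :: "nat \<Rightarrow> nat \<Rightarrow> nat list \<Rightarrow> coeff list" where
  "y_tuple N n al = map (bethe_root N n) (sorted_list_of_set (I_set al))"

definition bethe_vector :: "nat \<Rightarrow> nat \<Rightarrow> nat list \<Rightarrow> state" where
  "bethe_vector N n al = (\<Sum>lam \<in> partitions_in_box n (N - n).
     smul (factorial_schur (dual_partition (N - n) lam) (y_tuple N n al) (\<lambda>i. fps_const (T i)))
       (ket (word N lam)))"

end

theory Submission
  imports Defs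
begin

text \<open>
  The basis vectors of \<open>V\<^sub>n\<close> are indexed by the \<open>n\<close>-subsets \<open>S = I(\<lambda>)\<close> of \<open>{1..N}\<close>. In these terms the
  coefficient of a basis vector in the Bethe vector is a quotient of two alternants
  \<open>det ((y\<^sub>i | T)\<^sup>e)\<close>: the exponents \<open>e\<close> are the numbers \<open>N - l\<close> with \<open>l \<in> S\<close> in the numerator, and
  \<open>0, \<dots>, n - 1\<close> in the denominator.

  The operator \<open>s\<^sub>j\<close> exchanges \<open>T\<^sub>p\<close> and \<open>T\<^sub>p\<^sub>+\<^sub>1\<close> for \<open>p = N - j\<close>, and it exchanges the Bethe roots \<open>y\<^sub>j\<close>
  and \<open>y\<^sub>j\<^sub>+\<^sub>1\<close>. If the letters \<open>j\<close> and \<open>j + 1\<close> of \<open>\<alpha>\<close> agree, then the exchange of the roots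
  permutes the columns of both determinants in the same way, hence does not change the quotient.
  What remains is the exchange of \<open>T\<^sub>p\<close> and \<open>T\<^sub>p\<^sub>+\<^sub>1\<close>. A factorial power \<open>(x | T)\<^sup>r\<close> is symmetric in
  these two except when \<open>r = p\<close>, and then it changes by \<open>(T\<^sub>p - T\<^sub>p\<^sub>+\<^sub>1) (x | T)\<^bsup>p - 1\<^esup>\<close>. So an
  alternant changes in at most one row, and the change is \<open>T\<^sub>p - T\<^sub>p\<^sub>+\<^sub>1\<close> times the alternant in which
  the exponent \<open>p\<close> is replaced by \<open>p - 1\<close> (lemma \<open>alternant_transpose\<close>). That alternant
  vanishes if \<open>p - 1\<close> is already an exponent, which is always so for the denominator. In the
  numerator, \<open>p\<close> is an exponent iff \<open>j \<in> S\<close>, and \<open>p - 1\<close> is one iff \<open>j + 1 \<in> S\<close>; the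
  replacement moves the letter 1 from place \<open>j\<close> to place \<open>j + 1\<close>. This is precisely how
  \<open>\<delta>\<^sub>j\<^sup>\<or>\<close> collects the coefficients, and \<open>T\<^sub>p - T\<^sub>p\<^sub>+\<^sub>1 = - (t\<^sub>j - t\<^sub>j\<^sub>+\<^sub>1)\<close>
  (lemma \<open>s_coeff_subset_coeff\<close>).
\<close>

section \<open>Alternants of factorial powers\<close>

definition alternant :: "coeff list \<Rightarrow> (nat \<Rightarrow> coeff) \<Rightarrow> nat list \<Rightarrow> coeff" where
  "alternant xs a es = det (mat (length es) (length es)
     (\<lambda>(i, j). factorial_power (xs ! j) a (es ! i)))"

lemma factorial_schur_eq_alternant:
  "factorial_schur lam xs a =
     alternant xs a (map (\<lambda>i. lam ! i + length lam - (i + 1)) [0..<length lam]) /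
     alternant xs a (map (\<lambda>i. length lam - (i + 1)) [0..<length lam])"
proof -
  have "mat m m (\<lambda>(i, j). factorial_power (xs ! j) a (f i)) =
      mat m m (\<lambda>(i, j). factorial_power (xs ! j) a (map f [0..<m] ! i))" for f m
    by (rule eq_matI) auto
  then show ?thesis
    by (simp add: factorial_schur_def alternant_def Let_def)
qed

text \<open>
  The product \<open>(x - a\<^sub>1) \<dots> (x - a\<^sub>r)\<close> contains neither or both of the factors with indices \<open>p\<close>
  and \<open>p + 1\<close>, unless \<open>r = p\<close>; then its last factor is \<open>x - a\<^sub>p\<close> and becomes
  \<open>x - a\<^sub>p\<^sub>+\<^sub>1 = (x - a\<^sub>p) + (a\<^sub>p - a\<^sub>p\<^sub>+\<^sub>1)\<close>.
\<close>

lemma factorial_power_transpose: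
  assumes "1 \<le> p"
  shows "factorial_power x (a \<circ> transpose p (Suc p)) r =
    (if r = p then factorial_power x a p + (a p - a (Suc p)) * factorial_power x a (p - 1)
     else factorial_power x a r)"
proof -
  consider "r < p" | "r = p" | "p < r" by linarith
  then show ?thesis
  proof cases
    case 1
    then show ?thesis
      unfolding factorial_power_def by (auto intro!: prod.cong simp: transpose_def)
  next
    case 2
    obtain p' where p': "p = Suc p'" using assms by (cases p) auto
    have "(\<Prod>i = 1..p'. x - (a \<circ> transpose p (Suc p)) i) = (\<Prod>i = 1..p'. x - a i)"
      by (rule prod.cong) (auto simp: p' transpose_def)
    then show ?thesis
      by (simp add: 2 factorial_power_def p' algebra_simps)
  next
    case 3
    have "bij_betw (transpose p (Suc p)) {1..r} {1..r}"
      by (rule bij_betw_byWitness[where f' = "transpose p (Suc p)"])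
        (use assms 3 in \<open>auto simp: transpose_def\<close>)
    then have "(\<Prod>i = 1..r. x - a (transpose p (Suc p) i)) = (\<Prod>i = 1..r. x - a i)"
      by (rule prod.reindex_bij_betw)
    then show ?thesis using 3 by (simp add: factorial_power_def)
  qed
qed

lemma det_linear_in_row:
  fixes f g h :: "nat \<Rightarrow> nat \<Rightarrow> 'a :: comm_ring_1"
  assumes m: "m < n"
    and row: "\<And>j. j < n \<Longrightarrow> f m j = g m j + c * h m j"
    and others: "\<And>i j. i < n \<Longrightarrow> j < n \<Longrightarrow> i \<noteq> m \<Longrightarrow> f i j = g i j \<and> h i j = g i j"
  shows "det (mat n n (\<lambda>(i, j). f i j)) =
    det (mat n n (\<lambda>(i, j). g i j)) + c * det (mat n n (\<lambda>(i, j). h i j))"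
proof -
  let ?M = "\<lambda>f :: nat \<Rightarrow> nat \<Rightarrow> 'a. mat n n (\<lambda>(i, j). f i j)"
  have delete: "mat_delete (?M u) m j = mat_delete (?M g) m j"
    if "\<And>i j. i < n \<Longrightarrow> j < n \<Longrightarrow> i \<noteq> m \<Longrightarrow> u i j = g i j" for u j
    by (rule eq_matI) (auto simp: mat_delete_def intro!: that)
  have cof: "cofactor (?M f) m j = cofactor (?M g) m j"
    "cofactor (?M h) m j = cofactor (?M g) m j" for j
    using delete[of f j] delete[of h j] others by (auto simp: cofactor_def)
  have expand: "det (?M u) = (\<Sum>j<n. u m j * cofactor (?M u) m j)" for u
    by (subst laplace_expansion_row[OF _ m]) (use m in auto)
  have "det (?M f) = (\<Sum>j<n. (g m j + c * h m j) * cofactor (?M g) m j)"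
    unfolding expand[of f] by (rule sum.cong) (simp_all add: row cof)
  also have "\<dots> = det (?M g) + c * det (?M h)"
    unfolding expand[of g] expand[of h]
    by (simp add: cof sum.distrib sum_distrib_left algebra_simps)
  finally show ?thesis .
qed

lemma alternant_repeated_exponent:
  assumes "i < length es" "i' < length es" "i \<noteq> i'" "es ! i = es ! i'"
  shows "alternant xs a es = 0"
  unfolding alternant_def
  by (rule det_identical_rows[OF _ assms(3,1,2)]) (use assms in \<open>auto intro!: eq_vecI\<close>)

text \<open>
  Since the exponents are distinct, at most one row has exponent \<open>p\<close>, and only this row is
  affected by the exchange of \<open>a\<^sub>p\<close> and \<open>a\<^sub>p\<^sub>+\<^sub>1\<close>. Linearity in the row gives the correction term,
  which has two equal rows if \<open>p - 1\<close> occurs among the exponents as well.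
\<close>

lemma alternant_transpose:
  assumes p: "1 \<le> p" and es: "distinct es"
  shows "alternant xs (a \<circ> transpose p (Suc p)) es = alternant xs a es +
    (if p \<in> set es \<and> p - 1 \<notin> set es
     then (a p - a (Suc p)) * alternant xs a (map (\<lambda>r. if r = p then p - 1 else r) es) else 0)"
proof (cases "p \<in> set es")
  case False
  then have "mat (length es) (length es)
        (\<lambda>(i, j). factorial_power (xs ! j) (a \<circ> transpose p (Suc p)) (es ! i)) =
      mat (length es) (length es) (\<lambda>(i, j). factorial_power (xs ! j) a (es ! i))"
    by (intro eq_matI) (auto simp: factorial_power_transpose[OF p])
  with False show ?thesis by (simp add: alternant_def)
next
  case True
  then obtain m where m: "m < length es" "es ! m = p" by (auto simp: in_set_conv_nth)
  define es' where "es' = map (\<lambda>r. if r = p then p - 1 else r) es"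
  have other: "es ! i \<noteq> p" if "i < length es" "i \<noteq> m" for i
    using that m es nth_eq_iff_index_eq by metis
  have "alternant xs (a \<circ> transpose p (Suc p)) es =
      alternant xs a es + (a p - a (Suc p)) * alternant xs a es'"
    unfolding alternant_def es'_def length_map
    by (rule det_linear_in_row[OF m(1)])
      (use m other in \<open>auto simp: factorial_power_transpose[OF p]\<close>)
  moreover have "alternant xs a es' = 0" if pred: "p - 1 \<in> set es"
  proof -
    obtain i where i: "i < length es" "es ! i = p - 1"
      using pred by (auto simp: in_set_conv_nth)
    then have "i \<noteq> m" using m p by auto
    then show ?thesis
      using alternant_repeated_exponent[of i es' m xs a] i m p by (simp add: es'_def)
  qed
  ultimately show ?thesis using True by (auto simp: es'_def)
qed

text \<open>
  The exponents \<open>n - 1, \<dots>, 0\<close> are closed under predecessor, so that the correction term is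
  always zero. This alternant is the denominator of a factorial Schur function.
\<close>

lemma alternant_staircase_transpose:
  assumes p: "1 \<le> p"
  shows "alternant xs (a \<circ> transpose p (Suc p)) (map (\<lambda>i. n - (i + 1)) [0..<n])
    = alternant xs a (map (\<lambda>i. n - (i + 1)) [0..<n])"
proof -
  define fs where "fs = map (\<lambda>i. n - (i + 1)) [0..<n]"
  have "inj_on (\<lambda>i. n - (i + 1)) {0..<n}"
  proof (rule inj_onI)
    fix i i' assume "i \<in> {0..<n}" "i' \<in> {0..<n}" and eq: "n - (i + 1) = n - (i' + 1)"
    then have "i < n" "i' < n" by simp_all
    with eq show "i = i'" by linarith
  qed
  then have "distinct fs" unfolding fs_def distinct_map set_upt by simp
  note transpose = alternant_transpose[OF p this, of xs a]
  have "p - 1 \<in> set fs" if "p \<in> set fs"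
  proof -
    have "p \<le> n - 1" using that by (auto simp: fs_def)
    with p have "p - 1 = n - ((n - p) + 1)" "n - p \<in> {0..<n}" by auto
    then show ?thesis unfolding fs_def set_map set_upt by blast
  qed
  then have no: "(p \<in> set fs \<and> p - 1 \<notin> set fs) = False" by blast
  show ?thesis
    using transpose unfolding no if_False add_0_right unfolding fs_def .
qed

text \<open>
  Reordering the variables permutes columns; the resulting sign does not depend on the exponents
  or on the shifts \<open>a\<close>, which is why it cancels from quotients of alternants.
\<close>

lemma alternant_permute:
  assumes "mset ys = mset xs"
  obtains e :: coeff where "e = 1 \<or> e = -1"
    and "\<And>a es. length es = length xs \<Longrightarrow> alternant ys a es = e * alternant xs a es"
proof -
  from assms obtain p where p: "p permutes {..<length xs}" "permute_list p xs = ys"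
    by (rule mset_eq_permutation)
  have "alternant ys a es = signof p * alternant xs a es" if len: "length es = length xs" for a es
  proof -
    let ?n = "length xs"
    let ?A = "\<lambda>xs. mat ?n ?n (\<lambda>(i, j). factorial_power (xs ! i) a (es ! j))"
    have tr: "alternant zs a es = det (?A zs)" for zs
      unfolding alternant_def len
      by (subst det_transpose[symmetric, of _ ?n]) (auto intro!: arg_cong[where f = det] eq_matI)
    have "?A ys = mat ?n ?n (\<lambda>(i, j). ?A xs $$ (p i, j))"
      using p permutes_in_image[OF p(1)]
      by (intro eq_matI) (auto simp: permute_list_nth simp flip: p(2))
    then show ?thesis
      unfolding tr
      by (simp add: det_permute_rows[of "?A xs" ?n p] p(1) atLeast0LessThan)
  qed
  moreover have "(signof p :: coeff) = 1 \<or> (signof p :: coeff) = -1"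
    by (simp add: sign_def)
  ultimately show thesis by (intro that)
qed

lemma alternant_quotient_permute:
  assumes "mset ys = mset xs" "length es = length xs" "length fs = length xs"
  shows "alternant ys a es / alternant ys b fs = alternant xs a es / alternant xs b fs"
proof -
  obtain e :: coeff where e: "e = 1 \<or> e = -1"
    "\<And>a es. length es = length xs \<Longrightarrow> alternant ys a es = e * alternant xs a es"
    using alternant_permute[OF assms(1)] by blast
  then show ?thesis using assms by auto
qed

section \<open>The action on power series\<close>

lemma fps_nth_s_coeff:
  "fps_nth (s_coeff N j f) i = swap_ratfun (N + 1 - j) (N + 1 - (j + 1)) (fps_nth f i)"
  by (simp add: s_coeff_def)

lemma s_coeff_ring_hom: "comm_ring_hom (s_coeff N j)"
  by unfold_locales (simp_all add: s_coeff_0 s_coeff_1 s_coeff_add s_coeff_mult)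

lemma swap_ratfun_eq_0_iff: "swap_ratfun a b x = 0 \<longleftrightarrow> x = 0"
  by (cases x) (auto simp: swap_ratfun_Fract Zero_fract_def eq_fract swap_mpol_eq_0_iff
      swap_mpol_0 swap_mpol_1)

text \<open>
  Division of power series shifts away the order of the divisor and multiplies by the inverse of
  its unit part. A field automorphism acting on coefficients preserves the order, hence
  commutes with each of these steps, whether or not the division is exact.
\<close>

lemma s_coeff_divide: "s_coeff N j (f / g) = s_coeff N j f / s_coeff N j g"
proof (cases "g = 0")
  case True
  then show ?thesis by (simp add: s_coeff_0)
next
  case False
  have shift: "s_coeff N j (fps_shift i h) = fps_shift i (s_coeff N j h)" for i h
    by (rule fps_ext) (simp add: fps_nth_s_coeff)
  have sd: "subdegree (s_coeff N j g) = subdegree g"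
    using False by (intro subdegreeI) (auto simp: fps_nth_s_coeff swap_ratfun_eq_0_iff)
  define h where "h = unit_factor g"
  have h0: "fps_nth h 0 \<noteq> 0" using False by (simp add: h_def)
  have sh: "unit_factor (s_coeff N j g) = s_coeff N j h"
    by (simp add: h_def fps_unit_factor_def sd shift)
  have sh0: "fps_nth (s_coeff N j h) 0 \<noteq> 0"
    using h0 by (simp add: fps_nth_s_coeff swap_ratfun_eq_0_iff)
  have "s_coeff N j h * s_coeff N j (inverse h) = s_coeff N j (inverse h * h)"
    by (simp add: s_coeff_mult mult.commute)
  also have "\<dots> = 1" using inverse_mult_eq_1[OF h0] by (simp add: s_coeff_1)
  finally have "inverse (s_coeff N j h) = s_coeff N j (inverse h)"
    using sh0 by (metis fps_inverse_unique)
  then show ?thesis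
    by (simp add: fps_divide_def sd sh shift s_coeff_mult del: fps_unit_factor_def flip: h_def)
qed

lemma fps_const_mult_divide:
  fixes f g :: "'a :: field fps"
  shows "(fps_const c * f) / g = fps_const c * (f / g)"
  unfolding fps_divide_def by (rule fps_ext) (simp add: mult.assoc)

lemma s_coeff_T:
  assumes "j \<le> N"
  shows "s_coeff N j (fps_const (T i)) = fps_const (T (transpose (N - j) (Suc (N - j)) i))"
proof -
  have *: "N + 1 - j = Suc (N - j)" "N + 1 - (j + 1) = N - j" using assms by auto
  show ?thesis
    by (rule fps_ext)
      (simp only: fps_nth_s_coeff fps_nth_fps_const swap_ratfun_T swap_ratfun_0 *
        transpose_commute[of "N - j"] if_distrib[of "swap_ratfun _ _"])
qed

lemma s_coeff_alternant:
  assumes "length es \<le> length xs"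
  shows "s_coeff N j (alternant xs a es) = alternant (map (s_coeff N j) xs) (s_coeff N j \<circ> a) es"
proof -
  interpret comm_ring_hom "s_coeff N j" by (rule s_coeff_ring_hom)
  have "s_coeff N j (factorial_power x a r) = factorial_power (s_coeff N j x) (s_coeff N j \<circ> a) r"
    for x r
    by (simp add: factorial_power_def hom_prod hom_minus)
  then show ?thesis
    unfolding alternant_def hom_det[symmetric]
    using assms by (intro arg_cong[where f = det] eq_matI) auto
qed

section \<open>Partitions in a box as subsets\<close>

text \<open>
  With \<open>j\<close> in the set and \<open>j + 1\<close> not, the transposition is strictly increasing on the set.
\<close>

lemma sorted_list_of_set_transpose:
  assumes "finite S" "j \<in> S" "Suc j \<notin> S"
  shows "sorted_list_of_set (transpose j (Suc j) ` S)
    = map (transpose j (Suc j)) (sorted_list_of_set S)"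
proof -
  have "sorted_wrt (<) (map (transpose j (Suc j)) (sorted_list_of_set S))"
    unfolding sorted_wrt_map
    by (rule sorted_wrt_mono_rel[OF _ strict_sorted_list_of_set])
      (use assms in \<open>auto simp: transpose_def\<close>)
  moreover have "set (map (transpose j (Suc j)) (sorted_list_of_set S)) = transpose j (Suc j) ` S"
    using assms(1) by simp
  ultimately show ?thesis
    by (metis sorted_list_of_set.idem_if_sorted_distinct strict_sorted_iff)
qed

lemma strictly_sorted_nth_gap:
  fixes P :: "nat list"
  assumes "sorted_wrt (<) P" "i \<le> i'" "i' < length P"
  shows "P ! i + (i' - i) \<le> P ! i'"
  using assms(2,3)
proof (induction i' rule: dec_induct)
  case (step m)
  have "P ! m < P ! Suc m"
    using assms(1) step by (simp add: sorted_wrt_iff_nth_less)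
  with step show ?case by simp
qed simp

text \<open>
  The elements of \<open>I(\<lambda>)\<close> in the order \<open>i = 1, \<dots>, n\<close>, which is increasing because the parts of
  \<open>\<lambda>\<close> are taken from the smallest to the largest.
\<close>

definition I_list :: "nat list \<Rightarrow> nat list" where
  "I_list lam = map (\<lambda>i. lam ! (length lam - 1 - i) + (i + 1)) [0..<length lam]"

lemma I_set_eq_set_I_list: "I_set lam = set (I_list lam)"
proof -
  let ?n = "length lam"
  have "I_set lam = (\<lambda>i. lam ! (?n + 1 - i - 1) + i) ` {i. 1 \<le> i \<and> i \<le> ?n}"
    by (auto simp: I_set_def)
  also have "{i. 1 \<le> i \<and> i \<le> ?n} = Suc ` {0..<?n}"
    by (auto simp: image_iff Suc_le_eq intro: Suc_pred' dest: gr0_implies_Suc)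
  also have "(\<lambda>i. lam ! (?n + 1 - i - 1) + i) ` Suc ` {0..<?n} = set (I_list lam)"
    unfolding image_image by (simp add: I_list_def)
  finally show ?thesis .
qed

lemma strictly_sorted_I_list:
  assumes "lam \<in> partitions_in_box n k"
  shows "sorted_wrt (<) (I_list lam)"
  unfolding sorted_wrt_iff_nth_less
proof (intro allI impI)
  fix i i' assume i: "i < i'" "i' < length (I_list lam)"
  then have "i' < length lam" by (simp add: I_list_def)
  with i(1) have "length lam - 1 - i' < length lam - 1 - i" "length lam - 1 - i < length lam"
    by simp_all
  then have "lam ! (length lam - 1 - i) \<le> lam ! (length lam - 1 - i')"
    using assms unfolding partitions_in_box_def sorted_wrt_iff_nth_less by blast
  then show "I_list lam ! i < I_list lam ! i'"
    using i(1) \<open>i' < length lam\<close> by (simp add: I_list_def)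
qed

lemma sorted_list_of_I_set:
  assumes "lam \<in> partitions_in_box n k"
  shows "sorted_list_of_set (I_set lam) = I_list lam"
  unfolding I_set_eq_set_I_list
  using strictly_sorted_I_list[OF assms]
  by (simp add: sorted_list_of_set.idem_if_sorted_distinct strict_sorted_iff)

text \<open>
  The inverse map subtracts \<open>i\<close> from the \<open>i\<close>-th smallest element of the subset. The differences
  are weakly increasing because a strictly increasing sequence of integers has gaps at least 1;
  comparison with its first and last entries shows that they lie between 0 and \<open>N - n\<close>.
\<close>

lemma bij_betw_I_set:
  assumes "n \<le> N"
  shows "bij_betw I_set (partitions_in_box n (N - n)) {S. S \<subseteq> {1..N} \<and> card S = n}"
  unfolding bij_betw_def
proof
  show "inj_on I_set (partitions_in_box n (N - n))"
  proof (rule inj_onI)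
    fix lam mu
    assume lam: "lam \<in> partitions_in_box n (N - n)" and mu: "mu \<in> partitions_in_box n (N - n)"
      and "I_set lam = I_set mu"
    then have eq: "I_list lam = I_list mu" by (metis sorted_list_of_I_set)
    have len: "length lam = n" "length mu = n"
      using lam mu by (auto simp: partitions_in_box_def)
    show "lam = mu"
    proof (rule nth_equalityI)
      fix m assume "m < length lam"
      then have "m < n" by (simp add: len)
      then show "lam ! m = mu ! m"
        using arg_cong[OF eq, of "\<lambda>P. P ! (n - 1 - m)"] by (simp add: I_list_def len)
    qed (simp add: len)
  qed
next
  show "I_set ` partitions_in_box n (N - n) = {S. S \<subseteq> {1..N} \<and> card S = n}"
  proof (intro equalityI subsetI)
    fix S assume "S \<in> I_set ` partitions_in_box n (N - n)"
    then obtain lam where lam: "lam \<in> partitions_in_box n (N - n)" and S: "S = I_set lam"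
      by auto
    have len: "length lam = n" using lam by (simp add: partitions_in_box_def)
    have "lam ! (n - 1 - i) + (i + 1) \<le> N" if "i < n" for i
    proof -
      have "lam ! (n - 1 - i) \<le> N - n"
        using lam that by (auto simp: partitions_in_box_def)
      then show ?thesis using that assms by linarith
    qed
    then have "S \<subseteq> {1..N}"
      by (auto simp: S I_set_eq_set_I_list I_list_def len)
    moreover have "card S = length (I_list lam)"
      unfolding S I_set_eq_set_I_list
      using strictly_sorted_I_list[OF lam] by (simp add: distinct_card strict_sorted_iff)
    then have "card S = n" by (simp add: I_list_def len)
    ultimately show "S \<in> {S. S \<subseteq> {1..N} \<and> card S = n}" by simp
  next
    fix S assume "S \<in> {S. S \<subseteq> {1..N} \<and> card S = n}"
    then have S: "S \<subseteq> {1..N}" "card S = n" by auto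
    then have fin: "finite S" using finite_subset by blast
    define P where "P = sorted_list_of_set S"
    have P: "sorted_wrt (<) P" "set P = S" "length P = n"
      using fin S by (simp_all add: P_def)
    have range: "1 \<le> P ! i" "P ! i \<le> N" if "i < n" for i
    proof -
      have "P ! i \<in> S" using that P nth_mem[of i P] by simp
      then show "1 \<le> P ! i" "P ! i \<le> N" using S by auto
    qed
    have gap: "P ! i + (i' - i) \<le> P ! i'" if "i \<le> i'" "i' < n" for i i'
      using strictly_sorted_nth_gap[OF P(1)] that P(3) by simp
    have low: "i + 1 \<le> P ! i" if "i < n" for i
      using gap[of 0 i] range[of 0] that by simp
    have high: "P ! i + (n - 1 - i) \<le> N" if "i < n" for i
    proof -
      have "i \<le> n - 1" "n - 1 < n" using that by auto
      then show ?thesis using gap[of i "n - 1"] range(2)[of "n - 1"] by linarith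
    qed
    define lam where "lam = map (\<lambda>m. P ! (n - 1 - m) - (n - m)) [0..<n]"
    have "lam \<in> partitions_in_box n (N - n)"
      unfolding partitions_in_box_def
    proof (intro CollectI conjI ballI)
      show "sorted_wrt (\<ge>) lam"
        unfolding sorted_wrt_iff_nth_less
      proof (intro allI impI)
        fix m m' assume "m < m'" "m' < length lam"
        then have m: "m < m'" "m' < n" by (simp_all add: lam_def)
        have "P ! (n - 1 - m') + (m' - m) \<le> P ! (n - 1 - m)"
          using gap[of "n - 1 - m'" "n - 1 - m"] m by simp
        moreover have "n - m = (n - m') + (m' - m)" using m by simp
        ultimately have "P ! (n - 1 - m') - (n - m') \<le> P ! (n - 1 - m) - (n - m)"
          using diff_le_mono by (metis diff_cancel2)
        then show "lam ! m' \<le> lam ! m" using m by (simp add: lam_def)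
      qed
      fix x assume "x \<in> set lam"
      then obtain m where "m < n" "x = P ! (n - 1 - m) - (n - m)" by (auto simp: lam_def)
      then show "x \<le> N - n" using high[of "n - 1 - m"] assms by simp
    qed (simp add: lam_def)
    moreover have "I_list lam = P"
    proof (rule nth_equalityI)
      fix i assume "i < length (I_list lam)"
      then have "i < n" by (simp add: I_list_def lam_def)
      then show "I_list lam ! i = P ! i"
        using low[of i] by (simp add: I_list_def lam_def)
    qed (simp add: I_list_def lam_def P)
    then have "I_set lam = S" by (simp add: I_set_eq_set_I_list P)
    ultimately show "S \<in> I_set ` partitions_in_box n (N - n)" by blast
  qed
qed

text \<open>
  Counted from 1, row \<open>i\<close> has exponent \<open>k - \<lambda>\<^sub>n\<^sub>+\<^sub>1\<^sub>-\<^sub>i + n - i = N - (\<lambda>\<^sub>n\<^sub>+\<^sub>1\<^sub>-\<^sub>i + i)\<close>, where \<open>k = N - n\<close>.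
\<close>

lemma dual_partition_exponents:
  assumes lam: "lam \<in> partitions_in_box n (N - n)" and "n \<le> N"
  shows "map (\<lambda>i. dual_partition (N - n) lam ! i + n - (i + 1)) [0..<n]
    = map (\<lambda>l. N - l) (sorted_list_of_set (I_set lam))"
proof (rule nth_equalityI)
  have len: "length lam = n" using lam by (simp add: partitions_in_box_def)
  then show "length (map (\<lambda>i. dual_partition (N - n) lam ! i + n - (i + 1)) [0..<n])
      = length (map (\<lambda>l. N - l) (sorted_list_of_set (I_set lam)))"
    by (simp add: sorted_list_of_I_set[OF lam] I_list_def)
  fix i assume "i < length (map (\<lambda>i. dual_partition (N - n) lam ! i + n - (i + 1)) [0..<n])"
  then have i: "i < n" by simp
  then have "lam ! (n - 1 - i) \<le> N - n"
    using lam by (auto simp: partitions_in_box_def)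
  then show "map (\<lambda>i. dual_partition (N - n) lam ! i + n - (i + 1)) [0..<n] ! i
      = map (\<lambda>l. N - l) (sorted_list_of_set (I_set lam)) ! i"
    using i assms(2)
    by (simp add: sorted_list_of_I_set[OF lam] I_list_def dual_partition_def len rev_nth)
qed

section \<open>Bethe vectors indexed by subsets\<close>

definition subset_word :: "nat \<Rightarrow> nat set \<Rightarrow> word01" where
  "subset_word N S = map (\<lambda>j. j \<in> S) [1..<N + 1]"

text \<open>
  For \<open>A = I(\<alpha>)\<close> and \<open>S = I(\<lambda>)\<close> this is the coefficient \<open>s\<^bsub>\<lambda>\<or>\<^esub>(y\<^sub>\<alpha> | T)\<close> of the Bethe vector, in which
  the exponents of the numerator are read off from the subset: moving the letter 1 from place
  \<open>j\<close> to \<open>j + 1\<close> lowers a single exponent by 1.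
\<close>

definition subset_coeff :: "nat \<Rightarrow> nat \<Rightarrow> nat set \<Rightarrow> nat set \<Rightarrow> coeff" where
  "subset_coeff N n A S =
     alternant (map (bethe_root N n) (sorted_list_of_set A)) (\<lambda>i. fps_const (T i))
       (map (\<lambda>l. N - l) (sorted_list_of_set S)) /
     alternant (map (bethe_root N n) (sorted_list_of_set A)) (\<lambda>i. fps_const (T i))
       (map (\<lambda>i. n - (i + 1)) [0..<n])"

lemma bethe_vector_eq_sum_subsets:
  assumes "n \<le> N"
  shows "bethe_vector N n al = (\<Sum>S | S \<subseteq> {1..N} \<and> card S = n.
    smul (subset_coeff N n (I_set al) S) (ket (subset_word N S)))"
proof -
  have "bethe_vector N n al = (\<Sum>lam \<in> partitions_in_box n (N - n).
      smul (subset_coeff N n (I_set al) (I_set lam)) (ket (subset_word N (I_set lam))))"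
    unfolding bethe_vector_def
  proof (rule sum.cong)
    fix lam assume lam: "lam \<in> partitions_in_box n (N - n)"
    then have "length (dual_partition (N - n) lam) = n"
      by (simp add: dual_partition_def partitions_in_box_def)
    with dual_partition_exponents[OF lam assms]
    have "factorial_schur (dual_partition (N - n) lam) (y_tuple N n al) (\<lambda>i. fps_const (T i)) =
        subset_coeff N n (I_set al) (I_set lam)"
      unfolding factorial_schur_eq_alternant subset_coeff_def y_tuple_def by (simp only:)
    then show "smul (factorial_schur (dual_partition (N - n) lam) (y_tuple N n al)
          (\<lambda>i. fps_const (T i))) (ket (word N lam)) =
        smul (subset_coeff N n (I_set al) (I_set lam)) (ket (subset_word N (I_set lam)))"
      by (simp add: word_def subset_word_def)
  qed simp
  then show ?thesis
    using sum.reindex_bij_betw[OF bij_betw_I_set[OF assms]] by simp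
qed

text \<open>
  The exchange relation for single coefficients. The hypothesis on \<open>A\<close> makes it stable under the
  transposition of \<open>j\<close> and \<open>j + 1\<close>, so that the action on the roots merely permutes the
  arguments. The images of \<open>j\<close> and \<open>j + 1\<close> under \<open>l \<mapsto> N - l\<close> are \<open>p\<close> and \<open>p - 1\<close> for
  \<open>p = N - j\<close>, which translates the correction term of \<open>alternant_transpose\<close> into a
  condition on \<open>S\<close>.
\<close>

lemma s_coeff_subset_coeff:
  assumes j: "1 \<le> j" "j < N" and A: "A \<subseteq> {1..N}" "card A = n" "j \<in> A \<longleftrightarrow> Suc j \<in> A"
    and S: "S \<subseteq> {1..N}" "card S = n"
  shows "s_coeff N j (subset_coeff N n A S) = subset_coeff N n A S +
    (if j \<in> S \<and> Suc j \<notin> S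
     then fps_const (t N (Suc j) - t N j) * subset_coeff N n A (transpose j (Suc j) ` S) else 0)"
proof -
  have fin: "finite A" "finite S" using A(1) S(1) finite_subset by auto
  define LA where "LA = sorted_list_of_set A"
  define LS where "LS = sorted_list_of_set S"
  define LS' where "LS' = sorted_list_of_set (transpose j (Suc j) ` S)"
  define y where "y = bethe_root N n"
  define a where "a = (\<lambda>i. fps_const (T i) :: coeff)"
  define p where "p = N - j"
  define s where "s = transpose j (Suc j)"
  define es where "es = map (\<lambda>l. N - l) LS"
  define es' where "es' = map (\<lambda>l. N - l) LS'"
  define fs where "fs = map (\<lambda>i. n - (i + 1)) [0..<n]"
  have LA: "set LA = A" "distinct LA" "length LA = n" using fin A by (simp_all add: LA_def)
  have LS: "set LS = S" "distinct LS" "sorted_wrt (<) LS" "length LS = n"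
    using fin S by (simp_all add: LS_def)
  have len: "length es = n" "length fs = n" by (simp_all add: es_def fs_def LS)
  have p: "1 \<le> p" using j by (simp add: p_def)
  have C: "subset_coeff N n A S = alternant (map y LA) a es / alternant (map y LA) a fs"
    by (simp add: subset_coeff_def LA_def LS_def y_def a_def es_def fs_def)
  have C': "subset_coeff N n A (s ` S) = alternant (map y LA) a es' / alternant (map y LA) a fs"
    by (simp add: subset_coeff_def LA_def LS'_def y_def a_def es'_def fs_def s_def)
  have roots: "map (s_coeff N j) (map y LA) = map y (map s LA)"
    using A LA(1) j s_coeff_bethe_root[of j N _ n] by (auto simp: y_def s_def)
  have "s ` A = A"
    using A(3) by (auto simp: s_def transpose_image_eq)
  moreover have "distinct (map s LA)"
    using LA by (simp add: distinct_map s_def)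
  ultimately have "mset (map s LA) = mset LA"
    by (metis LA(1,2) set_eq_iff_mset_eq_distinct set_map)
  then have perm: "mset (map y (map s LA)) = mset (map y LA)" by (simp only: mset_map)
  have nodes: "s_coeff N j \<circ> a = a \<circ> transpose p (Suc p)"
    using j by (auto simp: a_def s_coeff_T p_def)
  have le: "l \<le> N" if "l \<in> S" for l using that S(1) by auto
  have "distinct es"
    unfolding es_def distinct_map LS(1)
    by (intro conjI LS(2) inj_onI) (metis le diff_diff_cancel)
  note swap_es = alternant_transpose[OF p this, of "map y LA" a]
  have swap_fs: "alternant (map y LA) (a \<circ> transpose p (Suc p)) fs = alternant (map y LA) a fs"
    unfolding fs_def by (rule alternant_staircase_transpose[OF p])
  \<comment> \<open>\<open>l \<mapsto> N - l\<close> is injective only up to \<open>N\<close>, where subtraction is not truncated.\<close>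
  have "N - i \<in> set es \<longleftrightarrow> i \<in> S" if "i \<le> N" for i
  proof
    assume "N - i \<in> set es"
    then obtain l where l: "l \<in> S" "N - i = N - l" by (auto simp: es_def LS(1))
    then have "l = i" using le[OF l(1)] that by linarith
    with l show "i \<in> S" by simp
  qed (auto simp: es_def LS(1))
  from this[of j] this[of "Suc j"]
  have mem: "p \<in> set es \<longleftrightarrow> j \<in> S" "p - 1 \<in> set es \<longleftrightarrow> Suc j \<in> S"
    using j by (simp_all add: p_def)
  have shifted: "map (\<lambda>r. if r = p then p - 1 else r) es = es'" if "j \<in> S" "Suc j \<notin> S"
  proof -
    have sLS: "LS' = map s LS"
      unfolding LS_def LS'_def s_def using fin(2) that by (rule sorted_list_of_set_transpose)
    have "(if N - l = p then p - 1 else N - l) = N - s l" if "l \<in> S" for l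
    proof -
      have "l \<noteq> Suc j" "l \<le> N" using that \<open>Suc j \<notin> S\<close> S(1) by auto
      then show ?thesis using j by (auto simp: p_def s_def transpose_def)
    qed
    then show ?thesis
      by (simp add: es_def es'_def sLS LS(1))
  qed
  have "s_coeff N j (subset_coeff N n A S) =
      alternant (map y (map s LA)) (a \<circ> transpose p (Suc p)) es /
      alternant (map y (map s LA)) (a \<circ> transpose p (Suc p)) fs"
    unfolding C s_coeff_divide
    by (subst (1 2) s_coeff_alternant) (simp_all only: len length_map LA roots nodes order.refl)
  also have "\<dots> = alternant (map y LA) (a \<circ> transpose p (Suc p)) es /
      alternant (map y LA) (a \<circ> transpose p (Suc p)) fs"
    by (rule alternant_quotient_permute[OF perm]) (simp_all add: len LA)
  also have "\<dots> = (alternant (map y LA) a es + (if j \<in> S \<and> Suc j \<notin> S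
      then (a p - a (Suc p)) * alternant (map y LA) a es' else 0)) / alternant (map y LA) a fs"
  proof (cases "j \<in> S \<and> Suc j \<notin> S")
    case True
    show ?thesis
      unfolding swap_es swap_fs mem shifted[OF conjunct1[OF True] conjunct2[OF True]] by (rule refl)
  next
    case False
    then show ?thesis unfolding swap_es swap_fs mem by (simp only: if_False)
  qed
  also have "\<dots> = subset_coeff N n A S + (if j \<in> S \<and> Suc j \<notin> S
      then fps_const (T p - T (Suc p)) * subset_coeff N n A (s ` S) else 0)"
  proof -
    have "a p - a (Suc p) = fps_const (T p - T (Suc p))" by (simp add: a_def)
    then show ?thesis
      unfolding C C' by (simp add: fps_divide_add fps_const_mult_divide)
  qed
  finally have "s_coeff N j (subset_coeff N n A S) = subset_coeff N n A S +
      (if j \<in> S \<and> Suc j \<notin> S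
       then fps_const (T p - T (Suc p)) * subset_coeff N n A (s ` S) else 0)" .
  moreover have "T p = t N (Suc j)" "T (Suc p) = t N j"
    using j by (simp_all add: t_def p_def Suc_diff_le)
  ultimately show ?thesis by (simp only: s_def)
qed

section \<open>Operators on states\<close>

lemma lookup_smul: "Poly_Mapping.lookup (smul c v) w = c * Poly_Mapping.lookup v w"
  by (simp add: smul_def map.rep_eq when_def)

lemma lookup_s_state: "Poly_Mapping.lookup (s_state N j v) w = s_coeff N j (Poly_Mapping.lookup v w)"
  by (simp add: s_state_def map.rep_eq when_def s_coeff_0)

lemma lookup_linear_extension:
  "Poly_Mapping.lookup (linear_extension \<phi> v) u =
     (\<Sum>w \<in> Poly_Mapping.keys v. Poly_Mapping.lookup v w * Poly_Mapping.lookup (\<phi> w) u)"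
  by (simp add: linear_extension_def lookup_sum lookup_smul)

text \<open>
  If each basis vector is sent to a basis vector or to zero and \<open>u\<close> has at most one preimage
  \<open>w0\<close>, then the coefficient at \<open>u\<close> of the image is a single coefficient, that at \<open>w0\<close>. The
  proposition \<open>Q\<close> says that the preimage exists.
\<close>

lemma lookup_linear_extension_partial_inverse:
  assumes "\<And>w. P w \<and> f w = u \<longleftrightarrow> Q \<and> w = w0"
  shows "Poly_Mapping.lookup (linear_extension (\<lambda>w. if P w then ket (f w) else 0) v) u =
    (if Q then Poly_Mapping.lookup v w0 else 0)"
proof -
  have "Poly_Mapping.lookup (if P w then ket (f w) else 0) u = (if w = w0 then of_bool Q else 0)" for w
    using assms[of w] by (auto simp: ket_def lookup_single when_def)
  then show ?thesis
    by (simp add: lookup_linear_extension if_distrib[of "\<lambda>x. _ * x"] sum.delta in_keys_iff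
        cong: if_cong)
qed

lemma lookup_sigma_plus:
  assumes "j - 1 < length u"
  shows "Poly_Mapping.lookup (sigma_plus j v) u =
    (if u ! (j - 1) then Poly_Mapping.lookup v (u[j - 1 := False]) else 0)"
proof -
  have "(\<not> w ! (j - 1)) \<and> w[j - 1 := True] = u \<longleftrightarrow> u ! (j - 1) \<and> w = u[j - 1 := False]" for w
    using assms by (metis (full_types) length_list_update list_update_id list_update_overwrite
        nth_list_update_eq)
  moreover have "(\<lambda>w. if w ! (j - 1) then 0 else ket (w[j - 1 := True])) =
      (\<lambda>w. if \<not> w ! (j - 1) then ket (w[j - 1 := True]) else 0)" by auto
  ultimately show ?thesis
    unfolding sigma_plus_def by (simp only: lookup_linear_extension_partial_inverse)
qed

lemma lookup_sigma_minus:
  assumes "j - 1 < length u"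
  shows "Poly_Mapping.lookup (sigma_minus j v) u =
    (if \<not> u ! (j - 1) then Poly_Mapping.lookup v (u[j - 1 := True]) else 0)"
proof -
  have "w ! (j - 1) \<and> w[j - 1 := False] = u \<longleftrightarrow> (\<not> u ! (j - 1)) \<and> w = u[j - 1 := True]" for w
    using assms by (metis (full_types) length_list_update list_update_id list_update_overwrite
        nth_list_update_eq)
  then show ?thesis
    unfolding sigma_minus_def by (rule lookup_linear_extension_partial_inverse)
qed

lemma lookup_delta_check:
  assumes "1 \<le> j" "j < length u"
  shows "Poly_Mapping.lookup (delta_check j v) u =
    (if u ! (j - 1) \<and> \<not> u ! j
     then Poly_Mapping.lookup v (u[j - 1 := False, j := True]) else 0)"
  using assms by (simp add: delta_check_def lookup_sigma_plus lookup_sigma_minus)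

text \<open>
  An update at a position outside a word leaves the word unchanged, so that the formulas for the
  coefficients of \<open>\<sigma>\<^sup>\<plusminus>\<close> hold only at words that are long enough. The coefficients at words of
  other lengths than \<open>N\<close> are zero, because the operators preserve the length.
\<close>

lemma linear_extension_homogeneous:
  assumes "\<And>w. Poly_Mapping.lookup v w \<noteq> 0 \<Longrightarrow> length w = N"
    and "\<And>w u. Poly_Mapping.lookup (\<phi> w) u \<noteq> 0 \<Longrightarrow> length u = length w"
    and "Poly_Mapping.lookup (linear_extension \<phi> v) u \<noteq> 0"
  shows "length u = N"
proof -
  obtain w where "w \<in> Poly_Mapping.keys v" "Poly_Mapping.lookup (\<phi> w) u \<noteq> 0"
    using assms(3) unfolding lookup_linear_extension
    by (metis (no_types, lifting) mult_zero_right sum.neutral)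
  then show ?thesis using assms(1,2) by (metis in_keys_iff)
qed

lemma delta_check_homogeneous:
  assumes v: "\<And>w. Poly_Mapping.lookup v w \<noteq> 0 \<Longrightarrow> length w = N"
    and "Poly_Mapping.lookup (delta_check j v) u \<noteq> 0"
  shows "length u = N"
proof -
  have minus: "length u = N" if "Poly_Mapping.lookup (sigma_minus (j + 1) v) u \<noteq> 0" for u
    by (rule linear_extension_homogeneous[OF v _ that[unfolded sigma_minus_def]])
      (auto simp: ket_def lookup_single when_def split: if_splits)
  show ?thesis
    by (rule linear_extension_homogeneous[OF minus _ assms(2)[unfolded delta_check_def sigma_plus_def]])
      (auto simp: ket_def lookup_single when_def split: if_splits)
qed

lemma length_subset_word [simp]: "length (subset_word N S) = N"
  by (simp add: subset_word_def del: upt_Suc)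

lemma nth_subset_word: "i < N \<Longrightarrow> subset_word N S ! i \<longleftrightarrow> Suc i \<in> S"
  by (simp add: subset_word_def del: upt_Suc)

lemma subset_word_inject:
  assumes "S \<subseteq> {1..N}" "S' \<subseteq> {1..N}"
  shows "subset_word N S = subset_word N S' \<longleftrightarrow> S = S'"
proof
  assume eq: "subset_word N S = subset_word N S'"
  have "i \<in> S \<longleftrightarrow> i \<in> S'" if "i \<in> {1..N}" for i
    using that nth_subset_word[of "i - 1" N S] nth_subset_word[of "i - 1" N S'] eq by fastforce
  with assms show "S = S'" by blast
qed simp

lemma lookup_bethe_vector:
  assumes "n \<le> N" "S \<subseteq> {1..N}"
  shows "Poly_Mapping.lookup (bethe_vector N n al) (subset_word N S) =
    (if card S = n then subset_coeff N n (I_set al) S else 0)"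
proof -
  let ?F = "{S. S \<subseteq> {1..N} \<and> card S = n}"
  have "finite ?F" by simp
  have "Poly_Mapping.lookup (bethe_vector N n al) (subset_word N S) =
      (\<Sum>S' \<in> ?F. if S' = S then subset_coeff N n (I_set al) S' else 0)"
    unfolding bethe_vector_eq_sum_subsets[OF assms(1)] lookup_sum
    by (rule sum.cong)
      (use subset_word_inject[OF _ assms(2)] in \<open>auto simp: lookup_smul ket_def lookup_single when_def\<close>)
  then show ?thesis using \<open>finite ?F\<close> assms(2) by simp
qed

lemma bethe_vector_homogeneous:
  assumes "n \<le> N" "Poly_Mapping.lookup (bethe_vector N n al) w \<noteq> 0"
  shows "length w = N"
proof (rule ccontr)
  assume "length w \<noteq> N"
  then have "subset_word N S \<noteq> w" for S by auto
  with assms show False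
    by (simp add: bethe_vector_eq_sum_subsets lookup_sum lookup_smul ket_def lookup_single)
qed

lemma word_eq_subset_word:
  obtains S where "S \<subseteq> {1..length w}" "w = subset_word (length w) S"
proof
  let ?S = "{i. 1 \<le> i \<and> i \<le> length w \<and> w ! (i - 1)}"
  show "?S \<subseteq> {1..length w}" by auto
  show "w = subset_word (length w) ?S"
    by (rule nth_equalityI) (auto simp: nth_subset_word)
qed

section \<open>The exchange relation\<close>

text \<open>
  At the word of \<open>S\<close>, the operator \<open>\<delta>\<^sub>j\<^sup>\<or>\<close> picks the coefficient at the word with letters 01 at the
  places \<open>j, j + 1\<close> if that of \<open>S\<close> has 10 there. The former is the word of the image of \<open>S\<close>
  under the transposition, so that the claim is the exchange relation for coefficients.
\<close>

lemma s_state_bethe_vector: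
  assumes n: "n \<le> N" and al: "al \<in> partitions_in_box n (N - n)" and j: "1 \<le> j" "j < N"
    and A: "j \<in> I_set al \<longleftrightarrow> Suc j \<in> I_set al"
  shows "s_state N j (bethe_vector N n al) = bethe_vector N n al -
    smul (fps_const (t N j - t N (j + 1))) (delta_check j (bethe_vector N n al))"
proof (rule poly_mapping_eqI)
  let ?v = "bethe_vector N n al"
  fix w
  show "Poly_Mapping.lookup (s_state N j ?v) w = Poly_Mapping.lookup (?v -
      smul (fps_const (t N j - t N (j + 1))) (delta_check j ?v)) w"
  proof (cases "length w = N")
    case False
    \<comment> \<open>At words of other lengths both sides are zero.\<close>
    then have "Poly_Mapping.lookup ?v w = 0" "Poly_Mapping.lookup (delta_check j ?v) w = 0"
      using bethe_vector_homogeneous[OF n] delta_check_homogeneous by blast+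
    then show ?thesis by (simp add: lookup_s_state lookup_minus lookup_smul s_coeff_0)
  next
    case True
    then obtain S where S: "S \<subseteq> {1..N}" and w: "w = subset_word N S"
      using word_eq_subset_word by metis
    define S' where "S' = transpose j (Suc j) ` S"
    have S': "S' \<subseteq> {1..N}"
      using S j by (auto simp: S'_def transpose_def split: if_splits)
    have card: "card S' = card S" unfolding S'_def by (rule card_image) simp
    have "w[j - 1 := False, j := True] = subset_word N S'" if "j \<in> S" "Suc j \<notin> S"
    proof (rule nth_equalityI)
      fix i assume "i < length (w[j - 1 := False, j := True])"
      then have i: "i < N" using True by simp
      have "Suc i \<in> S' \<longleftrightarrow> transpose j (Suc j) (Suc i) \<in> S"
        unfolding S'_def by (metis image_eqI imageE transpose_involutory)
      with that i j show "w[j - 1 := False, j := True] ! i \<longleftrightarrow> subset_word N S' ! i"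
        by (auto simp: w nth_subset_word nth_list_update transpose_def)
    qed (simp add: w)
    then have delta: "Poly_Mapping.lookup (delta_check j ?v) w =
        (if j \<in> S \<and> Suc j \<notin> S then Poly_Mapping.lookup ?v (subset_word N S') else 0)"
      using j True by (simp add: lookup_delta_check w nth_subset_word)
    have "I_set al \<in> {S. S \<subseteq> {1..N} \<and> card S = n}"
      using bij_betwE[OF bij_betw_I_set[OF n]] al by blast
    then have "s_coeff N j (subset_coeff N n (I_set al) S) = subset_coeff N n (I_set al) S +
      (if j \<in> S \<and> Suc j \<notin> S
       then fps_const (t N (Suc j) - t N j) * subset_coeff N n (I_set al) S' else 0)"
      if "card S = n"
      using s_coeff_subset_coeff[OF j _ _ A S that] by (simp add: S'_def)
    then show ?thesis
      unfolding lookup_s_state lookup_minus lookup_smul delta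
      by (auto simp: w lookup_bethe_vector[OF n S] lookup_bethe_vector[OF n S'] card s_coeff_0
          algebra_simps simp flip: fps_const_sub)
  qed
qed

theorem corollary5p16:
  fixes N n k :: nat and \<alpha> :: "nat list"
  assumes "0 < n" and "n < N" and "k = N - n"
    and "\<alpha> \<in> partitions_in_box n k"
  shows "\<forall>j. 1 \<le> j \<and> j \<le> N - 1 \<and> p_word j (word N \<alpha>) = word N \<alpha> \<longrightarrow>
      r_hat N j (bethe_vector N n \<alpha>) = s_state N j (bethe_vector N n \<alpha>) \<and>
      delta_check j (bethe_vector N n \<alpha>) = partial_state N j (bethe_vector N n \<alpha>)"
proof (intro allI impI)
  fix j assume *: "1 \<le> j \<and> j \<le> N - 1 \<and> p_word j (word N \<alpha>) = word N \<alpha>"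
  then have j: "1 \<le> j" "j < N" using assms by auto
  let ?v = "bethe_vector N n \<alpha>" and ?w = "word N \<alpha>" and ?d = "t N j - t N (j + 1)"
  have "?w = subset_word N (I_set \<alpha>)" by (simp add: word_def subset_word_def)
  moreover have "p_word j ?w ! j = ?w ! (j - 1)"
    using j by (simp add: p_word_def word_def del: upt_Suc)
  ultimately have "j \<in> I_set \<alpha> \<longleftrightarrow> Suc j \<in> I_set \<alpha>"
    using * j by (simp add: nth_subset_word)
  then have eq: "s_state N j ?v = ?v - smul (fps_const ?d) (delta_check j ?v)"
    using assms j by (intro s_state_bethe_vector) auto
  have "?d \<noteq> 0" using j by (auto simp: t_def T_inject)
  then have "fps_const (inverse ?d) * (fps_const ?d * f) = f" for f
    by (simp add: mult.assoc[symmetric])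
  then have "partial_state N j ?v = delta_check j ?v"
    unfolding partial_state_def eq by (intro poly_mapping_eqI) (simp add: lookup_smul)
  with eq show "r_hat N j ?v = s_state N j ?v \<and> delta_check j ?v = partial_state N j ?v"
    by (simp add: r_hat_def)
qed

end
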